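(* Let $G$ be a countable directed graph with no sinks and let $\mathcal{A}$ be any Banach algebra. If $\tau:\mathcal{A}\to\mathfrak{L}_G$ is a surjective algebra homomorphism, then $\tau$ is (automatically) norm-continuous.
   Context: A countable directed graph $G$ has countable vertex set $\mathcal{V}(G)$, edge set $\mathcal{E}(G)$, range and source maps $r,s$; a sink is a vertex which is the source of no edge. The free semigroupoid $\mathbb{F}^+(G)$ consists of vertices and finite paths $w=e_k\cdots e_1$ with $s(e_i)=r(e_{i-1})$, $s(w)=s(e_1)$, $r(w)=r(e_k)$. On $\mathcal{H}_G=\ell^2(\mathbb{F}^+(G))$ with orthonormal basis $\{\xi_w\}$, $L_e\xi_w=\xi_{ew}$ if $s(e)=r(w)$ and $0$ otherwise, and $P_v$ is the projection onto $\overline{\operatorname{span}}\{\xi_w:r(w)=v\}$. The free semigroupoid algebra $\mathfrak{L}_G$ is the weak operator topology closed algebra generated by all $L_e$ and $P_v$, equipped with the operator norm. *)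

theory Defs
  imports "HOL-Analysis.Analysis" "HOL-Library.Countable"
begin

text \<open>A countable directed graph is given by a vertex type 'v and an edge type 'e
(both of class countable; vertex set = UNIV, edge set = UNIV) together with
range and source maps rg, sr :: 'e => 'v.
Elements of the free semigroupoid are encoded in the type ('v + 'e list):
Inl v is the vertex v, and Inr [e_k, ..., e_1] is the path e_k ... e_1
(head of the list = last edge = e_k), which must be nonempty and composable.\<close>

type_synonym ('v, 'e) gpath = "'v + 'e list"

definition fsg_paths :: "('e \<Rightarrow> 'v) \<Rightarrow> ('e \<Rightarrow> 'v) \<Rightarrow> ('v, 'e) gpath set" where
  "fsg_paths rg sr = range Inl \<union>
     Inr ` {es. es \<noteq> [] \<and> (\<forall>i. Suc i < length es \<longrightarrow> sr (es ! i) = rg (es ! Suc i))}"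

fun path_range :: "('e \<Rightarrow> 'v) \<Rightarrow> ('v, 'e) gpath \<Rightarrow> 'v" where
  "path_range rg (Inl v) = v"
| "path_range rg (Inr es) = rg (hd es)"

definition has_no_sinks :: "('e \<Rightarrow> 'v) \<Rightarrow> bool" where
  "has_no_sinks sr \<longleftrightarrow> (\<forall>v. \<exists>e. sr e = v)"

definition l2G :: "('e \<Rightarrow> 'v) \<Rightarrow> ('e \<Rightarrow> 'v) \<Rightarrow> (('v, 'e) gpath \<Rightarrow> complex) set" where
  "l2G rg sr = {x. (\<forall>u. u \<notin> fsg_paths rg sr \<longrightarrow> x u = 0) \<and>
                   (\<lambda>u. (norm (x u))\<^sup>2) summable_on UNIV}"

definition l2norm :: "('a \<Rightarrow> complex) \<Rightarrow> real" where
  "l2norm x = sqrt (\<Sum>\<^sub>\<infinity>u. (norm (x u))\<^sup>2)"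

definition l2inner :: "('a \<Rightarrow> complex) \<Rightarrow> ('a \<Rightarrow> complex) \<Rightarrow> complex" where
  "l2inner x y = (\<Sum>\<^sub>\<infinity>u. x u * cnj (y u))"

text \<open>Bounded operators on H_G, represented extensionally: maps on functions
that send H_G into H_G, are complex-linear and bounded on H_G, and are 0 off H_G
(so that equality of operators is equality of functions).\<close>

definition bopG :: "('e \<Rightarrow> 'v) \<Rightarrow> ('e \<Rightarrow> 'v) \<Rightarrow>
   ((('v, 'e) gpath \<Rightarrow> complex) \<Rightarrow> (('v, 'e) gpath \<Rightarrow> complex)) set" where
  "bopG rg sr = {T.
      (\<forall>x. x \<notin> l2G rg sr \<longrightarrow> T x = (\<lambda>u. 0)) \<and>
      (\<forall>x\<in>l2G rg sr. T x \<in> l2G rg sr) \<and>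
      (\<forall>x\<in>l2G rg sr. \<forall>y\<in>l2G rg sr. T (\<lambda>u. x u + y u) = (\<lambda>u. T x u + T y u)) \<and>
      (\<forall>x\<in>l2G rg sr. \<forall>c::complex. T (\<lambda>u. c * x u) = (\<lambda>u. c * T x u)) \<and>
      (\<exists>K. \<forall>x\<in>l2G rg sr. l2norm (T x) \<le> K * l2norm x)}"

definition opnormG :: "('e \<Rightarrow> 'v) \<Rightarrow> ('e \<Rightarrow> 'v) \<Rightarrow>
   ((('v, 'e) gpath \<Rightarrow> complex) \<Rightarrow> (('v, 'e) gpath \<Rightarrow> complex)) \<Rightarrow> real" where
  "opnormG rg sr T = Sup {l2norm (T x) | x. x \<in> l2G rg sr \<and> l2norm x \<le> 1}"

text \<open>L_e xi_w = xi_{ew} if s(e) = r(w), else 0. In coordinates: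
(L_e x)(u) = x(w) if u = e w is a path, else 0.\<close>
definition opL :: "('e \<Rightarrow> 'v) \<Rightarrow> ('e \<Rightarrow> 'v) \<Rightarrow> 'e \<Rightarrow>
   (('v, 'e) gpath \<Rightarrow> complex) \<Rightarrow> (('v, 'e) gpath \<Rightarrow> complex)" where
  "opL rg sr e x = (if x \<in> l2G rg sr then
      (\<lambda>u. case u of
              Inl _ \<Rightarrow> 0
            | Inr [] \<Rightarrow> 0
            | Inr (e' # es) \<Rightarrow>
                (if e' = e \<and> u \<in> fsg_paths rg sr
                 then x (if es = [] then Inl (sr e) else Inr es) else 0))
      else (\<lambda>u. 0))"

definition opP :: "('e \<Rightarrow> 'v) \<Rightarrow> ('e \<Rightarrow> 'v) \<Rightarrow> 'v \<Rightarrow>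
   (('v, 'e) gpath \<Rightarrow> complex) \<Rightarrow> (('v, 'e) gpath \<Rightarrow> complex)" where
  "opP rg sr v x = (if x \<in> l2G rg sr then
      (\<lambda>u. if u \<in> fsg_paths rg sr \<and> path_range rg u = v then x u else 0)
      else (\<lambda>u. 0))"

inductive_set alg_genG :: "('e \<Rightarrow> 'v) \<Rightarrow> ('e \<Rightarrow> 'v) \<Rightarrow>
   ((('v, 'e) gpath \<Rightarrow> complex) \<Rightarrow> (('v, 'e) gpath \<Rightarrow> complex)) set"
  for rg sr where
  gen_L: "opL rg sr e \<in> alg_genG rg sr"
| gen_P: "opP rg sr v \<in> alg_genG rg sr"
| gen_add: "S \<in> alg_genG rg sr \<Longrightarrow> T \<in> alg_genG rg sr \<Longrightarrow> (\<lambda>x u. S x u + T x u) \<in> alg_genG rg sr"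
| gen_smult: "S \<in> alg_genG rg sr \<Longrightarrow> (\<lambda>x u. c * S x u) \<in> alg_genG rg sr"
| gen_mult: "S \<in> alg_genG rg sr \<Longrightarrow> T \<in> alg_genG rg sr \<Longrightarrow> S \<circ> T \<in> alg_genG rg sr"

text \<open>L_G: the closure of the generated algebra in B(H_G) for the weak operator
topology (T is in the WOT-closure iff every basic WOT neighbourhood of T, given by
finitely many pairs of vectors and an epsilon, meets the algebra).\<close>
definition freeSemigroupoidAlg :: "('e \<Rightarrow> 'v) \<Rightarrow> ('e \<Rightarrow> 'v) \<Rightarrow>
   ((('v, 'e) gpath \<Rightarrow> complex) \<Rightarrow> (('v, 'e) gpath \<Rightarrow> complex)) set" where
  "freeSemigroupoidAlg rg sr = {T \<in> bopG rg sr.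
      \<forall>F \<epsilon>. finite F \<and> F \<subseteq> l2G rg sr \<times> l2G rg sr \<and> \<epsilon> > 0 \<longrightarrow>
        (\<exists>S \<in> alg_genG rg sr. \<forall>(x, y) \<in> F. norm (l2inner (\<lambda>u. T x u - S x u) y) < \<epsilon>)}"

text \<open>A complex Banach algebra: a real Banach algebra (class real_normed_algebra + banach;
norm submultiplicative, complete) together with a complex scalar multiplication
extending the real one, making it a complex normed algebra.\<close>
definition complex_banach_algebra_smul :: "(complex \<Rightarrow> 'a::{real_normed_algebra, banach} \<Rightarrow> 'a) \<Rightarrow> bool" where
  "complex_banach_algebra_smul sm \<longleftrightarrow>
     (\<forall>r a. sm (complex_of_real r) a = scaleR r a) \<and>
     (\<forall>c a b. sm c (a + b) = sm c a + sm c b) \<and>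
     (\<forall>c d a. sm (c + d) a = sm c a + sm d a) \<and>
     (\<forall>c d a. sm (c * d) a = sm c (sm d a)) \<and>
     (\<forall>c a. norm (sm c a) = norm c * norm a) \<and>
     (\<forall>c a b. sm c (a * b) = sm c a * b) \<and>
     (\<forall>c a b. sm c (a * b) = a * sm c b)"

definition alg_homG :: "(complex \<Rightarrow> 'a::{real_normed_algebra, banach} \<Rightarrow> 'a) \<Rightarrow>
   ('a \<Rightarrow> ((('v, 'e) gpath \<Rightarrow> complex) \<Rightarrow> (('v, 'e) gpath \<Rightarrow> complex))) \<Rightarrow> bool" where
  "alg_homG sm \<tau> \<longleftrightarrow>
     (\<forall>a b. \<tau> (a + b) = (\<lambda>x u. \<tau> a x u + \<tau> b x u)) \<and>
     (\<forall>c a. \<tau> (sm c a) = (\<lambda>x u. c * \<tau> a x u)) \<and>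
     (\<forall>a b. \<tau> (a * b) = \<tau> a \<circ> \<tau> b)"

end

theory Submission
  imports Defs
begin

text \<open>
  By the uniform boundedness principle it suffices that every coordinate functional
  \<open>a \<mapsto> (\<tau> a x) w\<close> is bounded. If one is not, then, since
  \<open>(L\<^sub>e (\<tau> a x)) (ew) = (\<tau> a x) w\<close>, unboundedness propagates along an infinite path starting at
  the range of \<open>w\<close>, which exists because there are no sinks. This path either visits infinitely
  many vertices or can be chosen eventually periodic; in both cases there are operators
  \<open>T\<^sub>0, T\<^sub>1, \<dots>\<close> in the algebra such that \<open>T\<^sub>0 \<cdots> T\<^sub>n\<close> annihilates the \<open>n\<close>-th of a sequence of
  coordinates while \<open>T\<^sub>0 \<cdots> T\<^sub>n\<^sub>-\<^sub>1\<close> followed by it is still unbounded. A gliding hump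
  argument (in the style of Sinclair's stability lemma) then yields an element of the Banach
  algebra whose image has unbounded coordinates.
\<close>

section \<open>Uniform boundedness and a gliding hump\<close>

text \<open>The closed sets \<open>V k\<close> cover the space, so by Baire one of them contains a
  ball, and rescaling gives the bound. Seminorms replace linear maps here so that finite sections of
  an l2 norm can serve as \<open>q i\<close>.\<close>

lemma uniform_boundedness_seminorms:
  fixes q :: "'i \<Rightarrow> 'a::banach \<Rightarrow> real"
  assumes cont: "\<And>i. i \<in> I \<Longrightarrow> continuous_on UNIV (q i)"
    and triangle: "\<And>i a b. i \<in> I \<Longrightarrow> q i (a + b) \<le> q i a + q i b"
    and scale: "\<And>i r a. i \<in> I \<Longrightarrow> q i (r *\<^sub>R a) = \<bar>r\<bar> * q i a"
    and bdd: "\<And>a. \<exists>B. \<forall>i\<in>I. q i a \<le> B"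
  shows "\<exists>C\<ge>0. \<forall>i\<in>I. \<forall>a. q i a \<le> C * norm a"
proof -
  define V where "V k = {a. \<forall>i\<in>I. q i a \<le> real k}" for k
  have closedV: "closed (V k)" for k
  proof -
    have "V k = (\<Inter>i\<in>I. {a. q i a \<le> real k})"
      by (auto simp: V_def)
    moreover have "closed {a. q i a \<le> real k}" if "i \<in> I" for i
      using cont[OF that] by (intro closed_Collect_le continuous_on_const)
    ultimately show ?thesis
      by auto
  qed
  have cover: "(\<Union>k. V k) = UNIV"
  proof -
    have "\<exists>k. a \<in> V k" for a
    proof -
      obtain B where "\<forall>i\<in>I. q i a \<le> B"
        using bdd by blast
      moreover obtain k where "B \<le> real k"
        using real_arch_simple by blast
      ultimately show ?thesis
        by (intro exI[of _ k]) (auto simp: V_def intro: order_trans)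
    qed
    then show ?thesis by blast
  qed
  have "\<exists>k. interior (V k) \<noteq> {}"
  proof (rule ccontr)
    assume "\<not> ?thesis"
    then have "Met_TC.mtopology interior_of \<Union>(range V) = {}"
      using closedV
      by (intro Met_TC.metric_Baire_category_alt)
         (auto simp: mcomplete_iff_complete complete_UNIV)
    then show False
      using cover by simp
  qed
  then obtain k a0 r where r: "r > 0" "ball a0 r \<subseteq> V k"
    by (metis all_not_in_conv mem_interior)
  \<comment> \<open>The vector \<open>a\<close> is rescaled to norm \<open>r / 2\<close> and written
    as a difference of two points of the ball, which costs \<open>2 * k\<close>; hence the factor
    4.\<close>
  have "q i a \<le> (4 * real k / r) * norm a" if i: "i \<in> I" for i a
  proof (cases "a = 0")
    case True
    then show ?thesis
      using scale[OF i, of 0 0] by simp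
  next
    case False
    define b where "b = (r / (2 * norm a)) *\<^sub>R a"
    have "norm b < r"
      using False r(1) by (simp add: b_def)
    then have "a0 + b \<in> V k" "a0 \<in> V k"
      using r by (auto simp: dist_norm subset_iff)
    then have "q i (a0 + b) \<le> k" "q i a0 \<le> k"
      using i by (auto simp: V_def)
    moreover have "q i b \<le> q i (a0 + b) + q i (- a0)"
      using triangle[OF i, of "a0 + b" "- a0"] by simp
    moreover have "q i (- a0) = q i a0"
      using scale[OF i, of "-1" a0] by simp
    ultimately have "q i b \<le> 2 * k"
      by linarith
    moreover have "q i b = r / (2 * norm a) * q i a"
      using scale[OF i, of "r / (2 * norm a)" a] r(1) by (simp add: b_def)
    ultimately show ?thesis
      using False r(1) by (simp add: field_simps)
  qed
  then show ?thesis
    using r(1) by (intro exI[of _ "4 * real k / r"]) auto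
qed

text \<open>The composition of \<open>R k\<close>, ..., \<open>R (k + m - 1)\<close> with the
  highest index acting first, so for fixed \<open>k\<close> the ranges decrease as \<open>m\<close>
  grows.\<close>

primrec iterate_from :: "(nat \<Rightarrow> 'a \<Rightarrow> 'a) \<Rightarrow> nat \<Rightarrow> nat \<Rightarrow> 'a \<Rightarrow> 'a" where
  "iterate_from R k 0 a = a"
| "iterate_from R k (Suc m) a = iterate_from R k m (R (k + m) a)"

lemma iterate_from_Suc_left:
  "iterate_from R k (Suc m) a = R k (iterate_from R (Suc k) m a)"
  by (induction m arbitrary: a) auto

lemma bounded_linear_iterate_from:
  assumes "\<And>n. bounded_linear (R n)"
  shows "bounded_linear (iterate_from R k m)"
proof (induction m)
  case 0
  then show ?case
    by (simp add: bounded_linear_ident)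
next
  case (Suc m)
  then show ?case
    using bounded_linear_compose[OF Suc assms[of "k + m"]] by simp
qed

text \<open>The element is a series with terms \<open>W n (a n)\<close>. Unboundedness lets
  \<open>a n\<close> be small and still outweigh all earlier terms under \<open>f n\<close>, while
  all later terms together lie in the range of \<open>W (Suc n)\<close>, where \<open>f n\<close>
  vanishes.\<close>

lemma gliding_hump_exists_unbounded:
  fixes R :: "nat \<Rightarrow> 'a::banach \<Rightarrow> 'a" and f :: "nat \<Rightarrow> 'a \<Rightarrow> 'b::real_normed_vector"
  assumes R: "\<And>n. bounded_linear (R n)"
    and f: "\<And>n. linear (f n)"
    and unb: "\<And>n. \<not> bounded_linear (\<lambda>a. f n (iterate_from R 0 n a))"
    and kill: "\<And>n a. f n (iterate_from R 0 (Suc n) a) = 0"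
  shows "\<exists>a. \<forall>n. real n \<le> norm (f n a)"
proof -
  define W where "W = iterate_from R 0"
  have W: "bounded_linear (W n)" for n
    unfolding W_def by (rule bounded_linear_iterate_from[OF R])
  have "\<exists>K. 1 \<le> K \<and> (\<forall>a. norm (R n a) \<le> K * norm a)" for n
  proof -
    obtain K where K: "norm (R n a) \<le> norm a * K" for a
      using bounded_linear.bounded[OF R[of n]] by blast
    have "norm (R n a) \<le> max 1 K * norm a" for a
      using K[of a] mult_right_mono[of K "max 1 K" "norm a"] by (simp add: mult.commute)
    then show ?thesis
      by (intro exI[of _ "max 1 K"]) auto
  qed
  then obtain K where K1: "\<And>n. 1 \<le> K n" and K: "\<And>n a. norm (R n a) \<le> K n * norm a"
    by metis
  \<comment> \<open>The product of the \<open>K i\<close> bounds the norm of \<open>W n\<close>, and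
    the power of 1/2 supplies convergence: one application of \<open>R n\<close> turns the bound at
    \<open>Suc n\<close> into half the bound at \<open>n\<close>.\<close>
  define \<delta> where "\<delta> n = (1/2)^n / (\<Prod>i<n. K i)" for n :: nat
  have prodK: "(\<Prod>i<n. K i) \<ge> 1" for n
    using K1 by (intro prod_ge_1) auto
  have \<delta>_pos: "\<delta> n > 0" for n
    using prodK[of n] by (simp add: \<delta>_def)
  have \<delta>_step: "K n * \<delta> (Suc n) = \<delta> n / 2" for n
    using K1[of n] prodK[of n] by (simp add: \<delta>_def field_simps)
  have pick: "\<exists>a. norm a \<le> \<delta> n \<and> M \<le> norm (f n (W n a))" for n M
  proof (rule ccontr)
    assume none: "\<not> ?thesis"
    then have small: "norm a \<le> \<delta> n \<Longrightarrow> norm (f n (W n a)) < M" for a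
      by force
    have lin: "linear (\<lambda>a. f n (W n a))"
      using linear_compose[OF bounded_linear.linear[OF W] f] by (simp add: o_def)
    have "norm (f n (W n a)) \<le> norm a * (M / \<delta> n)" for a
    proof (cases "a = 0")
      case True
      then show ?thesis
        using linear_0[OF lin] by simp
    next
      case False
      have "norm (f n (W n ((\<delta> n / norm a) *\<^sub>R a))) < M"
        using False \<delta>_pos[of n] by (intro small) simp
      then have "\<delta> n / norm a * norm (f n (W n a)) < M"
        using linear_scale[OF lin, of "\<delta> n / norm a" a] \<delta>_pos[of n] by simp
      then show ?thesis
        using False \<delta>_pos[of n] by (simp add: field_simps)
    qed
    then have "bounded_linear (\<lambda>a. f n (W n a))"
      using lin by (intro bounded_linear.intro bounded_linear_axioms.intro) blast+
    then show False
      using unb[of n] by (simp add: W_def)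
  qed
  \<comment> \<open>The first component is the sum of the terms before index \<open>n\<close>, the
    second is the new \<open>a n\<close>. They are built together because \<open>a n\<close> must
    dominate the partial sum already formed.\<close>
  define good where "good n sa \<longleftrightarrow>
      norm (snd sa) \<le> \<delta> n \<and> real n + norm (f n (fst sa)) \<le> norm (f n (W n (snd sa)))"
    for n and sa :: "'a \<times> 'a"
  have "\<exists>X. (\<forall>n. good n (X n)) \<and> (\<forall>n. fst (X (Suc n)) = fst (X n) + W n (snd (X n)))
     \<and> fst (X 0) = 0"
  proof -
    have "\<exists>X. \<forall>n. (good n (X n) \<and> (n = 0 \<longrightarrow> fst (X n) = 0)) \<and>
        fst (X (Suc n)) = fst (X n) + W n (snd (X n))"
    proof (rule dependent_nat_choice)
      show "\<exists>sa. good 0 sa \<and> (0 = (0::nat) \<longrightarrow> fst sa = 0)"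
        using pick[of 0 "norm (f 0 0)"] by (force simp: good_def)
      show "\<exists>y. (good (Suc n) y \<and> (Suc n = 0 \<longrightarrow> fst y = 0)) \<and>
          fst y = fst sa + W n (snd sa)" for sa n
      proof -
        obtain a where "norm a \<le> \<delta> (Suc n)"
          "real (Suc n) + norm (f (Suc n) (fst sa + W n (snd sa))) \<le> norm (f (Suc n) (W (Suc n) a))"
          using pick by blast
        then show ?thesis
          by (intro exI[of _ "(fst sa + W n (snd sa), a)"]) (simp add: good_def)
      qed
    qed
    then show ?thesis by blast
  qed
  then obtain X where X: "\<And>n. good n (X n)" "fst (X 0) = 0"
    "\<And>n. fst (X (Suc n)) = fst (X n) + W n (snd (X n))"
    by blast
  define s where "s n = fst (X n)" for n
  define a where "a n = snd (X n)" for n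
  have a_small: "norm (a n) \<le> \<delta> n"
    and hump: "real n + norm (f n (s n)) \<le> norm (f n (W n (a n)))"
    and s_Suc: "s (Suc n) = s n + W n (a n)" for n
    using X(1)[of n] X(3)[of n] by (auto simp: good_def s_def a_def)
  have s_0: "s 0 = 0"
    by (simp add: s_def X(2))
  have from_le: "norm (iterate_from R k m b) \<le> c * (1/2)^m * \<delta> k"
    if "norm b \<le> c * \<delta> (k + m)" for k m b c
    using that
  proof (induction m arbitrary: b c)
    case 0
    then show ?case by simp
  next
    case (Suc m)
    have "norm (R (k + m) b) \<le> K (k + m) * norm b"
      by (rule K)
    also have "\<dots> \<le> K (k + m) * (c * \<delta> (Suc (k + m)))"
      using Suc.prems K1[of "k + m"] by (intro mult_left_mono) auto
    also have "\<dots> = c * (K (k + m) * \<delta> (Suc (k + m)))"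
      by simp
    also have "\<dots> = (c / 2) * \<delta> (k + m)"
      by (simp only: \<delta>_step)
    finally show ?case
      using Suc.IH[of "R (k + m) b" "c / 2"] by (simp add: mult_ac)
  qed
  \<comment> \<open>This is the tail from index \<open>k\<close> with the common prefix
    \<open>W k\<close> stripped off. It exhibits the whole remainder as a value of
    \<open>W (Suc n)\<close>, so \<open>f n\<close> annihilates it at once; a termwise argument
    would require continuity of \<open>f n\<close>.\<close>
  define t where "t k = (\<Sum>m. iterate_from R k m (a (k + m)))" for k
  have summ: "summable (\<lambda>m. iterate_from R k m (a (k + m)))" for k
  proof (rule summable_comparison_test')
    show "summable (\<lambda>m. (1/2)^m * \<delta> k)"
      by (intro summable_mult2 summable_geometric) simp
    show "norm (iterate_from R k m (a (k + m))) \<le> (1/2)^m * \<delta> k" for m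
      using from_le[of "a (k + m)" 1 k m] a_small by simp
  qed
  have t_rec: "t k = a k + R k (t (Suc k))" for k
  proof -
    have "t k = (\<Sum>m. iterate_from R k (Suc m) (a (k + Suc m))) + iterate_from R k 0 (a (k + 0))"
      unfolding t_def using suminf_split_head[OF summ[of k]] by simp
    also have "(\<Sum>m. iterate_from R k (Suc m) (a (k + Suc m)))
        = (\<Sum>m. R k (iterate_from R (Suc k) m (a (Suc k + m))))"
      by (simp only: iterate_from_Suc_left add_Suc_right add_Suc)
    also have "\<dots> = R k (t (Suc k))"
      unfolding t_def using bounded_linear.suminf[OF R summ] by metis
    finally show ?thesis
      by simp
  qed
  have W_Suc: "W (Suc n) b = W n (R n b)" for n b
    by (simp add: W_def)
  have W_add: "W n (b + c) = W n b + W n c" for n b c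
    using W linear_add bounded_linear.linear by blast
  have split: "t 0 = s n + W n (t n)" for n
  proof (induction n)
    case 0
    then show ?case
      by (simp add: s_0 W_def)
  next
    case (Suc n)
    then show ?case
      by (simp add: t_rec[of n] s_Suc W_Suc W_add add.assoc)
  qed
  have "real n \<le> norm (f n (t 0))" for n
  proof -
    have "t 0 = s n + W n (a n) + W (Suc n) (t (Suc n))"
      using split[of n] t_rec[of n] by (simp add: W_add W_Suc add.assoc)
    then have "f n (t 0) = f n (s n) + f n (W n (a n))"
      using kill[of n "t (Suc n)"] by (simp add: linear_add[OF f] W_def)
    then show ?thesis
      using hump[of n] norm_diff_ineq[of "f n (W n (a n))" "f n (s n)"] by (simp add: add.commute)
  qed
  then show ?thesis
    by blast
qed

section \<open>Partial reindexing operators\<close>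

lemma l2G_D:
  assumes "x \<in> l2G rg sr"
  shows "u \<notin> fsg_paths rg sr \<Longrightarrow> x u = 0" "(\<lambda>u. (norm (x u))\<^sup>2) summable_on UNIV"
  using assms by (auto simp: l2G_def)

lemma l2norm_nonneg: "0 \<le> l2norm x"
  unfolding l2norm_def by (intro real_sqrt_ge_zero infsum_nonneg) auto

lemma L2_set_le_l2norm:
  assumes "x \<in> l2G rg sr" "finite F"
  shows "L2_set (\<lambda>u. norm (x u)) F \<le> l2norm x"
  unfolding L2_set_def l2norm_def
  using assms by (intro real_sqrt_le_mono finite_sum_le_infsum l2G_D(2)) auto

lemma norm_le_l2norm:
  assumes "x \<in> l2G rg sr"
  shows "norm (x u) \<le> l2norm x"
  using L2_set_le_l2norm[OF assms, of "{u}"] by (simp add: L2_set_def)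

lemma l2norm_leI:
  assumes "x \<in> l2G rg sr" and "\<And>F. finite F \<Longrightarrow> L2_set (\<lambda>u. norm (x u)) F \<le> C"
  shows "l2norm x \<le> C"
proof -
  have "0 \<le> C"
    using assms(2)[of "{}"] by simp
  have "(\<Sum>\<^sub>\<infinity>u. (norm (x u))\<^sup>2) \<le> C\<^sup>2"
  proof (rule infsum_le_finite_sums)
    show "(\<lambda>u. (norm (x u))\<^sup>2) summable_on UNIV"
      by (rule l2G_D(2)[OF assms(1)])
    show "(\<Sum>u\<in>F. (norm (x u))\<^sup>2) \<le> C\<^sup>2" if "finite F" for F
      using assms(2)[OF that] \<open>0 \<le> C\<close> unfolding L2_set_def
      by (simp add: real_sqrt_le_iff' sum_nonneg real_le_lsqrt sqrt_le_D)
  qed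
  then show ?thesis
    unfolding l2norm_def using \<open>0 \<le> C\<close> real_le_lsqrt by blast
qed

lemma l2G_add:
  assumes "x \<in> l2G rg sr" "y \<in> l2G rg sr"
  shows "(\<lambda>u. x u + y u) \<in> l2G rg sr"
proof -
  have "(norm (a + b))\<^sup>2 \<le> 2 * (norm a)\<^sup>2 + 2 * (norm b)\<^sup>2" for a b :: complex
  proof -
    have "(norm (a + b))\<^sup>2 \<le> (norm a + norm b)\<^sup>2"
      by (intro power_mono norm_triangle_ineq) simp
    also have "\<dots> \<le> 2 * (norm a)\<^sup>2 + 2 * (norm b)\<^sup>2"
      using zero_le_power2[of "norm a - norm b"] by (simp add: power2_eq_square algebra_simps)
    finally show ?thesis .
  qed
  moreover have "(\<lambda>u. 2 * (norm (x u))\<^sup>2 + 2 * (norm (y u))\<^sup>2) summable_on UNIV"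
    using assms by (intro summable_on_add summable_on_cmult_right l2G_D(2))
  ultimately have "(\<lambda>u. (norm (x u + y u))\<^sup>2) summable_on UNIV"
    by - (rule summable_on_comparison_test, assumption, simp_all)
  then show ?thesis
    using assms by (auto simp: l2G_def)
qed

lemma l2G_smult:
  assumes "x \<in> l2G rg sr"
  shows "(\<lambda>u. c * x u) \<in> l2G rg sr"
  using assms
  by (auto simp: l2G_def norm_mult power_mult_distrib intro!: summable_on_cmult_right)

lemma l2G_zero: "(\<lambda>u. 0) \<in> l2G rg sr"
  by (auto simp: l2G_def)

text \<open>A common form for edge operators and vertex projections, so that one boundedness proof
  serves both.\<close>

definition reindex_op :: "('e \<Rightarrow> 'v) \<Rightarrow> ('e \<Rightarrow> 'v) \<Rightarrow> ('v, 'e) gpath set \<Rightarrow>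
    (('v, 'e) gpath \<Rightarrow> ('v, 'e) gpath) \<Rightarrow>
    (('v, 'e) gpath \<Rightarrow> complex) \<Rightarrow> (('v, 'e) gpath \<Rightarrow> complex)" where
  "reindex_op rg sr S t x =
     (if x \<in> l2G rg sr then (\<lambda>u. if u \<in> S then x (t u) else 0) else (\<lambda>u. 0))"

text \<open>By injectivity every finite partial sum of squares for the image is one for
  \<open>x\<close>, so the operator is a contraction.\<close>

lemma reindex_op_in_bopG:
  fixes rg sr :: "'e \<Rightarrow> 'v"
  assumes S: "S \<subseteq> fsg_paths rg sr" and inj: "inj_on t S"
  shows "reindex_op rg sr S t \<in> bopG rg sr"
proof -
  let ?T = "reindex_op rg sr S t"
  have sums: "L2_set (\<lambda>u. norm (?T x u)) F \<le> l2norm x"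
    if x: "x \<in> l2G rg sr" and F: "finite F" for x F
  proof -
    have "(\<Sum>u\<in>F. (norm (?T x u))\<^sup>2) = (\<Sum>u\<in>F \<inter> S. (norm (x (t u)))\<^sup>2)"
      using x F by (intro sum.mono_neutral_cong_right) (auto simp: reindex_op_def)
    also have "\<dots> = (\<Sum>u\<in>t ` (F \<inter> S). (norm (x u))\<^sup>2)"
      using inj by (subst sum.reindex) (auto intro: inj_on_subset)
    finally have "L2_set (\<lambda>u. norm (?T x u)) F = L2_set (\<lambda>u. norm (x u)) (t ` (F \<inter> S))"
      by (simp add: L2_set_def)
    then show ?thesis
      using L2_set_le_l2norm[OF x, of "t ` (F \<inter> S)"] F by simp
  qed
  have T_in: "?T x \<in> l2G rg sr" if x: "x \<in> l2G rg sr" for x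
  proof -
    have "(\<lambda>u. (norm (?T x u))\<^sup>2) summable_on UNIV"
    proof (rule nonneg_bdd_above_summable_on)
      show "bdd_above (sum (\<lambda>u. (norm (?T x u))\<^sup>2) ` {F. F \<subseteq> UNIV \<and> finite F})"
      proof (rule bdd_aboveI2)
        fix F :: "('v, 'e) gpath set" assume "F \<in> {F. F \<subseteq> UNIV \<and> finite F}"
        then show "(\<Sum>u\<in>F. (norm (?T x u))\<^sup>2) \<le> (l2norm x)\<^sup>2"
          using sums[OF x, of F] unfolding L2_set_def by (auto dest: sqrt_le_D)
      qed
    qed auto
    then show ?thesis
      using S x by (auto simp: l2G_def reindex_op_def)
  qed
  have bound: "l2norm (?T x) \<le> 1 * l2norm x" if "x \<in> l2G rg sr" for x
    using l2norm_leI[OF T_in sums] that by simp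
  show ?thesis
    unfolding bopG_def mem_Collect_eq
  proof (intro conjI allI ballI impI)
    show "\<exists>K. \<forall>x\<in>l2G rg sr. l2norm (?T x) \<le> K * l2norm x"
      using bound by blast
    show "?T x \<in> l2G rg sr" if "x \<in> l2G rg sr" for x
      by (rule T_in[OF that])
  qed (auto simp: fun_eq_iff reindex_op_def l2G_add l2G_smult)
qed


section \<open>Elements of the free semigroupoid algebra\<close>

lemma alg_genG_in_freeSemigroupoidAlg:
  assumes "T \<in> alg_genG rg sr" "T \<in> bopG rg sr"
  shows "T \<in> freeSemigroupoidAlg rg sr"
  unfolding freeSemigroupoidAlg_def mem_Collect_eq
proof (intro conjI allI impI)
  fix F \<epsilon> assume "finite F \<and> F \<subseteq> l2G rg sr \<times> l2G rg sr \<and> (0::real) < \<epsilon>"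
  then show "\<exists>S\<in>alg_genG rg sr. \<forall>(x, y)\<in>F. norm (l2inner (\<lambda>u. T x u - S x u) y) < \<epsilon>"
    using assms(1) by (intro bexI[of _ T]) (auto simp: l2inner_def)
qed (rule assms(2))

definition drop_edge :: "('e \<Rightarrow> 'v) \<Rightarrow> ('v, 'e) gpath \<Rightarrow> ('v, 'e) gpath" where
  "drop_edge sr u = (case u of Inr (e # es) \<Rightarrow> if es = [] then Inl (sr e) else Inr es | _ \<Rightarrow> u)"

lemma opL_eq_reindex_op:
  "opL rg sr e = reindex_op rg sr {u \<in> fsg_paths rg sr. \<exists>es. u = Inr (e # es)} (drop_edge sr)"
proof (intro ext)
  fix x u
  show "opL rg sr e x u
      = reindex_op rg sr {u \<in> fsg_paths rg sr. \<exists>es. u = Inr (e # es)} (drop_edge sr) x u"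
    by (cases u; cases "projr u")
       (auto simp: opL_def reindex_op_def drop_edge_def split: list.splits)
qed

lemma opL_in_freeSemigroupoidAlg: "opL rg sr e \<in> freeSemigroupoidAlg rg sr"
proof (rule alg_genG_in_freeSemigroupoidAlg)
  show "opL rg sr e \<in> bopG rg sr"
    unfolding opL_eq_reindex_op
    by (rule reindex_op_in_bopG) (auto simp: inj_on_def drop_edge_def split: if_splits)
qed (rule gen_L)

text \<open>The sum of the \<open>P_v\<close> over \<open>v\<close> in \<open>A\<close>. Infinite
  \<open>A\<close> matters: the complement of a single vertex is used later.\<close>

definition vertex_proj :: "('e \<Rightarrow> 'v) \<Rightarrow> ('e \<Rightarrow> 'v) \<Rightarrow> 'v set \<Rightarrow>
    (('v, 'e) gpath \<Rightarrow> complex) \<Rightarrow> (('v, 'e) gpath \<Rightarrow> complex)" where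
  "vertex_proj rg sr A = reindex_op rg sr {u \<in> fsg_paths rg sr. path_range rg u \<in> A} id"

lemma vertex_proj_apply:
  assumes "x \<in> l2G rg sr"
  shows "vertex_proj rg sr A x u = (if path_range rg u \<in> A then x u else 0)"
  using l2G_D(1)[OF assms, of u] assms by (auto simp: vertex_proj_def reindex_op_def)

lemma vertex_proj_finite_in_alg_genG:
  assumes "finite A"
  shows "vertex_proj rg sr A \<in> alg_genG rg sr"
  using assms
proof (induction A rule: finite_induct)
  case empty
  \<comment> \<open>The generation rules list no zero operator, so it is obtained as a zero multiple
    of a generator.\<close>
  have eq: "vertex_proj rg sr {} = (\<lambda>x u. 0 * opP rg sr undefined x u)"
    by (auto simp: vertex_proj_def reindex_op_def fun_eq_iff)
  show ?case
    unfolding eq by (rule gen_smult[OF gen_P])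
next
  case (insert v A)
  have eq: "vertex_proj rg sr (insert v A) = (\<lambda>x u. opP rg sr v x u + vertex_proj rg sr A x u)"
    using insert.hyps by (auto simp: vertex_proj_def reindex_op_def opP_def fun_eq_iff)
  show ?case
    unfolding eq by (rule gen_add[OF gen_P insert.IH])
qed

section \<open>Weak operator approximation of infinite vertex projections\<close>

lemma norm_mult_cnj_summable:
  assumes "x \<in> l2G rg sr" "y \<in> l2G rg sr"
  shows "(\<lambda>u. norm (x u * cnj (y u))) summable_on UNIV"
proof (rule Infinite_Sum.abs_summable_on_comparison_test')
  show "(\<lambda>u. (norm (x u))\<^sup>2 + (norm (y u))\<^sup>2) summable_on UNIV"
    using assms by (intro summable_on_add l2G_D(2))
  show "norm (x u * cnj (y u)) \<le> (norm (x u))\<^sup>2 + (norm (y u))\<^sup>2" for u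
  proof -
    have "2 * (norm (x u) * norm (y u)) \<le> (norm (x u))\<^sup>2 + (norm (y u))\<^sup>2"
      using sum_squares_bound[of "norm (x u)" "norm (y u)"] by simp
    moreover have "0 \<le> norm (x u) * norm (y u)"
      by simp
    ultimately show ?thesis
      unfolding norm_mult complex_mod_cnj by linarith
  qed
qed

text \<open>The estimate covers all larger \<open>V\<close> as well, so that finitely many pairs of
  vectors can share one set.\<close>

lemma finite_tail_small:
  fixes g :: "'i \<Rightarrow> real"
  assumes g: "g summable_on UNIV" and nonneg: "\<And>u. 0 \<le> g u" and "0 < \<epsilon>"
  shows "\<exists>U. finite U \<and> (\<forall>V. U \<subseteq> V \<longrightarrow> infsum g (- V) < \<epsilon>)"
proof -
  obtain U where U: "finite U" "dist (sum g U) (infsum g UNIV) \<le> \<epsilon> / 2"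
    using infsum_finite_approximation[OF g, of "\<epsilon> / 2"] \<open>0 < \<epsilon>\<close> by auto
  have summ: "g summable_on V" for V
    by (rule summable_on_subset_banach[OF g]) simp
  have "infsum g UNIV = infsum g U + infsum g (- U)"
    using infsum_Un_disjoint[of g U "- U"] summ by simp
  then have "infsum g (- U) < \<epsilon>"
    using U \<open>0 < \<epsilon>\<close> by (auto simp: dist_real_def)
  moreover have "infsum g (- V) \<le> infsum g (- U)" if "U \<subseteq> V" for V
    using that nonneg by (intro infsum_mono_neutral summ) auto
  ultimately show ?thesis
    using U(1) by (intro exI[of _ U] conjI allI impI) (auto intro: le_less_trans)
qed

text \<open>Projections for finite vertex sets approximate the given one weakly, since the products
  of coordinates of \<open>x\<close> and \<open>y\<close> are absolutely summable.\<close>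

lemma vertex_proj_in_freeSemigroupoidAlg:
  fixes rg sr :: "'e \<Rightarrow> 'v"
  shows "vertex_proj rg sr A \<in> freeSemigroupoidAlg rg sr"
  unfolding freeSemigroupoidAlg_def mem_Collect_eq
proof (intro conjI allI impI)
  show "vertex_proj rg sr A \<in> bopG rg sr"
    unfolding vertex_proj_def by (rule reindex_op_in_bopG) auto
next
  fix F :: "((('v, 'e) gpath \<Rightarrow> complex) \<times> (('v, 'e) gpath \<Rightarrow> complex)) set" and \<epsilon> :: real
  assume "finite F \<and> F \<subseteq> l2G rg sr \<times> l2G rg sr \<and> 0 < \<epsilon>"
  then have F: "finite F" "F \<subseteq> l2G rg sr \<times> l2G rg sr" and "0 < \<epsilon>"
    by auto
  let ?g = "\<lambda>x y u. norm (x u * cnj (y u))"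
  have "\<forall>xy\<in>F. \<exists>U. finite U \<and> (\<forall>V. U \<subseteq> V \<longrightarrow> infsum (?g (fst xy) (snd xy)) (- V) < \<epsilon>)"
  proof
    fix xy assume "xy \<in> F"
    then have "fst xy \<in> l2G rg sr" "snd xy \<in> l2G rg sr"
      using F(2) by auto
    from finite_tail_small[OF norm_mult_cnj_summable[OF this] norm_ge_zero \<open>0 < \<epsilon>\<close>]
    show "\<exists>U. finite U \<and> (\<forall>V. U \<subseteq> V \<longrightarrow> infsum (?g (fst xy) (snd xy)) (- V) < \<epsilon>)" .
  qed
  from bchoice[OF this] obtain U where
    U: "\<And>xy. xy \<in> F \<Longrightarrow> finite (U xy)"
      "\<And>xy V. xy \<in> F \<Longrightarrow> U xy \<subseteq> V \<Longrightarrow> infsum (?g (fst xy) (snd xy)) (- V) < \<epsilon>"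
    by auto
  define V where "V = \<Union> (U ` F)"
  \<comment> \<open>Only ranges of paths in the finite set \<open>V\<close> are kept. The two
    projections then agree on all coordinates in \<open>V\<close>, and the error is confined to the
    small tail outside \<open>V\<close>.\<close>
  define B where "B = A \<inter> path_range rg ` V"
  have "finite V"
    using F(1) U(1) by (auto simp: V_def)
  then have B: "vertex_proj rg sr B \<in> alg_genG rg sr"
    by (intro vertex_proj_finite_in_alg_genG) (simp add: B_def)
  have "norm (l2inner (\<lambda>u. vertex_proj rg sr A x u - vertex_proj rg sr B x u) y) < \<epsilon>"
    if xy: "(x, y) \<in> F" for x y
  proof -
    have x: "x \<in> l2G rg sr" and y: "y \<in> l2G rg sr"
      using xy F(2) by auto
    let ?d = "\<lambda>u. (vertex_proj rg sr A x u - vertex_proj rg sr B x u) * cnj (y u)"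
    have d_le: "norm (?d u) \<le> ?g x y u" for u
      by (simp add: vertex_proj_apply[OF x] B_def)
    have d_summ: "(\<lambda>u. norm (?d u)) summable_on UNIV"
      using Infinite_Sum.abs_summable_on_comparison_test'[OF norm_mult_cnj_summable[OF x y] d_le] .
    have "norm (infsum ?d UNIV) \<le> infsum (\<lambda>u. norm (?d u)) UNIV"
      by (rule norm_infsum_bound[OF d_summ])
    also have "\<dots> \<le> infsum (?g x y) (- V)"
    proof (rule infsum_mono_neutral[OF d_summ])
      show "?g x y summable_on - V"
        by (rule summable_on_subset_banach[OF norm_mult_cnj_summable[OF x y]]) simp
      show "norm (?d u) \<le> 0" if "u \<in> UNIV - - V" for u
        using that by (auto simp: vertex_proj_apply[OF x] B_def)
    qed (use d_le in auto)
    also have "\<dots> < \<epsilon>"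
      using U(2)[OF xy, of V] xy by (auto simp: V_def)
    finally show ?thesis
      by (simp add: l2inner_def)
  qed
  then show "\<exists>S\<in>alg_genG rg sr. \<forall>(x, y)\<in>F.
      norm (l2inner (\<lambda>u. vertex_proj rg sr A x u - S x u) y) < \<epsilon>"
    using B by blast
qed

section \<open>Coordinates along paths\<close>

fun extend_path :: "'e \<Rightarrow> ('v, 'e) gpath \<Rightarrow> ('v, 'e) gpath" where
  "extend_path e (Inl v) = Inr [e]"
| "extend_path e (Inr es) = Inr (e # es)"

fun path_length :: "('v, 'e) gpath \<Rightarrow> nat" where
  "path_length (Inl v) = 0"
| "path_length (Inr es) = length es"

lemma path_length_extend [simp]: "path_length (extend_path e p) = Suc (path_length p)"
  by (cases p) auto

lemma path_range_extend [simp]: "path_range rg (extend_path e p) = rg e"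
  by (cases p) auto

lemma extend_path_in_fsg_paths:
  assumes "p \<in> fsg_paths rg sr" "sr e = path_range rg p"
  shows "extend_path e p \<in> fsg_paths rg sr"
proof (cases p)
  case (Inl v)
  then show ?thesis
    by (auto simp: fsg_paths_def)
next
  case (Inr es)
  then have "es \<noteq> []" and es: "\<And>i. Suc i < length es \<Longrightarrow> sr (es ! i) = rg (es ! Suc i)"
    using assms(1) by (auto simp: fsg_paths_def)
  have "sr ((e # es) ! i) = rg ((e # es) ! Suc i)" if "Suc i < length (e # es)" for i
    using that es assms(2) Inr \<open>es \<noteq> []\<close> by (cases i) (auto simp: hd_conv_nth)
  then show ?thesis
    unfolding Inr by (auto simp: fsg_paths_def)
qed

lemma opL_extend_path:
  assumes "x \<in> l2G rg sr" "p \<in> fsg_paths rg sr" "sr e = path_range rg p"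
  shows "opL rg sr e x (extend_path e p) = x p"
  using assms extend_path_in_fsg_paths[OF assms(2,3)]
  by (cases p) (auto simp: opL_def fsg_paths_def)

text \<open>Multiplication by an edge lengthens every path by one, so it raises the order of
  vanishing by one.\<close>

lemma opL_eq_0_if_short:
  assumes "\<And>p. path_length p < m \<Longrightarrow> x p = 0" and "path_length p < Suc m"
  shows "opL rg sr e x p = 0"
proof (cases p)
  case (Inl v)
  then show ?thesis
    by (simp add: opL_def)
next
  case (Inr es)
  then show ?thesis
    using assms by (cases es) (auto simp: opL_def)
qed

text \<open>The product \<open>c (m-1) * ... * c 0 * a\<close>, formed as an action on
  \<open>a\<close> because the algebra need not have a unit to start an empty product.\<close>

primrec left_mult_upto :: "(nat \<Rightarrow> 'a) \<Rightarrow> nat \<Rightarrow> 'a \<Rightarrow> 'a::times" where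
  "left_mult_upto c 0 a = a"
| "left_mult_upto c (Suc m) a = c m * left_mult_upto c m a"

lemma bounded_linear_left_mult_upto:
  fixes c :: "nat \<Rightarrow> 'a::real_normed_algebra"
  shows "bounded_linear (left_mult_upto c m)"
proof (induction m)
  case 0
  then show ?case
    by (simp add: bounded_linear_ident)
next
  case (Suc m)
  then show ?case
    using bounded_linear_compose[OF bounded_linear_mult_right Suc, of "c m"] by simp
qed

section \<open>Coordinate functionals of a surjective homomorphism\<close>

locale hom_onto_freeSemigroupoidAlg =
  fixes rg sr :: "'e \<Rightarrow> 'v"
    and sm :: "complex \<Rightarrow> 'a::{real_normed_algebra, banach} \<Rightarrow> 'a"
    and \<tau> :: "'a \<Rightarrow> ((('v, 'e) gpath \<Rightarrow> complex) \<Rightarrow> (('v, 'e) gpath \<Rightarrow> complex))"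
  assumes smul: "complex_banach_algebra_smul sm"
    and hom: "alg_homG sm \<tau>"
    and onto: "range \<tau> = freeSemigroupoidAlg rg sr"
begin

lemma tau_in_bopG: "\<tau> a \<in> bopG rg sr"
  using onto by (auto simp: freeSemigroupoidAlg_def)

lemma tau_in_l2G: "x \<in> l2G rg sr \<Longrightarrow> \<tau> a x \<in> l2G rg sr"
  using tau_in_bopG[of a] by (simp add: bopG_def)

lemma tau_mult: "\<tau> (a * b) x = \<tau> a (\<tau> b x)"
  using hom by (simp add: alg_homG_def)

lemma linear_coordinate: "linear (\<lambda>a. \<tau> a x p)"
proof (rule linearI)
  show "\<tau> (a + b) x p = \<tau> a x p + \<tau> b x p" for a b
    using hom by (simp add: alg_homG_def)
  show "\<tau> (r *\<^sub>R a) x p = r *\<^sub>R \<tau> a x p" for r a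
    using hom smul unfolding alg_homG_def complex_banach_algebra_smul_def
    by (metis scaleR_conv_of_real)
qed

text \<open>Surjectivity enters here and in the next lemma: operators are lifted to algebra
  elements, by which left multiplication is continuous.\<close>

lemma edge_preimages:
  obtains b where "\<And>e. \<tau> (b e) = opL rg sr e"
  by (rule that[of "\<lambda>e. inv \<tau> (opL rg sr e)"], rule f_inv_into_f)
     (simp add: onto opL_in_freeSemigroupoidAlg)

lemma vertex_proj_preimages:
  obtains c where "\<And>A. \<tau> (c A) = vertex_proj rg sr A"
  by (rule that[of "\<lambda>A. inv \<tau> (vertex_proj rg sr A)"], rule f_inv_into_f)
     (simp add: onto vertex_proj_in_freeSemigroupoidAlg)

text \<open>The gliding hump would give an \<open>a\<close> whose coordinates
  \<open>\<tau> a x (p n)\<close> have modulus at least \<open>n\<close>, but coordinates of an l2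
  vector are bounded by its norm.\<close>

lemma no_gliding_hump:
  assumes x: "x \<in> l2G rg sr" and R: "\<And>n. bounded_linear (R n)"
    and unb: "\<And>n. \<not> bounded_linear (\<lambda>a. \<tau> (iterate_from R 0 n a) x (p n))"
    and kill: "\<And>n a. \<tau> (iterate_from R 0 (Suc n) a) x (p n) = 0"
  shows False
proof -
  obtain a where a: "\<And>n. real n \<le> norm (\<tau> a x (p n))"
    using gliding_hump_exists_unbounded[OF R linear_coordinate[of x "p _"] unb kill] by blast
  obtain n where "l2norm (\<tau> a x) < real n"
    using reals_Archimedean2 by blast
  then show False
    using a[of n] norm_le_l2norm[OF tau_in_l2G[OF x], of a "p n"] by linarith
qed

text \<open>If \<open>b e\<close> is a preimage of \<open>L_e\<close>, the coordinate of
  \<open>b e * a\<close> at the extended path equals that of \<open>a\<close> at \<open>p\<close>.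
  Boundedness would thus pass from the extended path back to \<open>p\<close>.\<close>

lemma unbounded_coordinate_extend:
  assumes x: "x \<in> l2G rg sr" and p: "p \<in> fsg_paths rg sr" and e: "sr e = path_range rg p"
    and unb: "\<not> bounded_linear (\<lambda>a. \<tau> a x p)"
  shows "\<not> bounded_linear (\<lambda>a. \<tau> a x (extend_path e p))"
proof
  assume bl: "bounded_linear (\<lambda>a. \<tau> a x (extend_path e p))"
  obtain b where b: "\<And>e. \<tau> (b e) = opL rg sr e"
    using edge_preimages by blast
  have "bounded_linear (\<lambda>a. \<tau> (b e * a) x (extend_path e p))"
    by (rule bounded_linear_compose[OF bl bounded_linear_mult_right])
  moreover have "\<tau> (b e * a) x (extend_path e p) = \<tau> a x p" for a
    by (simp add: tau_mult b opL_extend_path[OF tau_in_l2G[OF x] p e])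
  ultimately show False
    using unb by simp
qed

text \<open>If the path visits infinitely many vertices \<open>z n\<close>, the projections onto the complements
  of the \<open>z n\<close> produce the hump.\<close>
lemma finitely_many_unbounded_ranges:
  assumes x: "x \<in> l2G rg sr"
    and unb: "\<And>n::nat. \<not> bounded_linear (\<lambda>a. \<tau> a x (p n))"
  shows "finite (range (\<lambda>n. path_range rg (p n)))"
proof (rule ccontr)
  assume "\<not> ?thesis"
  then obtain z :: "nat \<Rightarrow> 'v" where "inj z" and z: "range z \<subseteq> range (\<lambda>n. path_range rg (p n))"
    using infinite_countable_subset by blast
  from z have "\<exists>k. z n = path_range rg (p k)" for n
    by blast
  then obtain k where k: "\<And>n. z n = path_range rg (p (k n))"
    by metis
  obtain c where c: "\<And>A. \<tau> (c A) = vertex_proj rg sr A"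
    using vertex_proj_preimages by blast
  \<comment> \<open>Multiplication by a preimage of the projection away from \<open>z n\<close>
    erases exactly the coordinates at paths with range \<open>z n\<close>.\<close>
  define R where "R n a = c (- {z n}) * a" for n a
  have R_apply: "\<tau> (R n a) x u = (if path_range rg u = z n then 0 else \<tau> a x u)" for n a u
    by (simp add: R_def tau_mult c vertex_proj_apply[OF tau_in_l2G[OF x]])
  \<comment> \<open>By injectivity of \<open>z\<close>, erasing \<open>z 0\<close>, ...,
    \<open>z (m - 1)\<close> with \<open>m \<le> n\<close> leaves a path with range
    \<open>z n\<close> untouched.\<close>
  have keep: "\<tau> (iterate_from R 0 m a) x (p (k n)) = \<tau> a x (p (k n))" if "m \<le> n" for m n a
    using that
  proof (induction m arbitrary: a)
    case (Suc m)
    then have "z n \<noteq> z m"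
      using \<open>inj z\<close> by (simp add: inj_eq)
    then show ?case
      using Suc by (simp add: R_apply k[symmetric])
  qed simp
  show False
  proof (rule no_gliding_hump[OF x, of R "\<lambda>n. p (k n)"])
    show "bounded_linear (R n)" for n
      unfolding R_def by (rule bounded_linear_mult_right)
    show "\<not> bounded_linear (\<lambda>a. \<tau> (iterate_from R 0 n a) x (p (k n)))" for n
      using unb by (simp add: keep)
    show "\<tau> (iterate_from R 0 (Suc n) a) x (p (k n)) = 0" for n a
      by (simp add: keep R_apply k[symmetric])
  qed
qed

text \<open>If the path is eventually periodic, powers of \<open>L\<^sub>d\<close> for a long enough cycle \<open>d\<close> do:
  \<open>L\<^sub>d\<^sup>m\<close> annihilates all coordinates at paths shorter than \<open>m\<close> times the length of \<open>d\<close>.\<close>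
lemma no_periodic_unbounded_path:
  assumes x: "x \<in> l2G rg sr"
    and p_in: "\<And>n. p n \<in> fsg_paths rg sr"
    and p_Suc: "\<And>n. p (Suc n) = extend_path (\<phi> (path_range rg (p n))) (p n)"
    and \<phi>: "\<And>v. sr (\<phi> v) = v"
    and unb: "\<not> bounded_linear (\<lambda>a. \<tau> a x (p 0))"
    and period: "path_range rg (p P) = path_range rg (p 0)" "0 < P"
  shows False
proof -
  let ?v = "\<lambda>n. path_range rg (p n)"
  \<comment> \<open>The next edge depends only on the current vertex, so a return to the initial
    vertex restarts the same itinerary.\<close>
  have v_shift: "?v (m + n) = ?v n" if "?v m = ?v 0" for m n
    by (induction n) (simp_all add: that p_Suc)
  have v_mult: "?v (j * P) = ?v 0" for j
    by (induction j) (simp_all add: v_shift period(1))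
  \<comment> \<open>As a multiple of the period, \<open>Q\<close> leads back to the initial vertex.
    As it exceeds the length of \<open>p 0\<close>, the path \<open>p (n * Q)\<close> is shorter
    than \<open>Suc n * Q\<close>, so \<open>Suc n\<close> rounds annihilate its coordinate.\<close>
  define Q where "Q = Suc (path_length (p 0)) * P"
  have Q: "path_length (p 0) < Q"
    using period(2) unfolding Q_def by (cases P) auto
  have v_Q: "?v (j * Q) = ?v 0" for j
    using v_mult[of "j * Suc (path_length (p 0))"] by (simp only: Q_def mult.assoc)
  have len: "path_length (p n) = path_length (p 0) + n" for n
    by (induction n) (simp_all add: p_Suc)
  obtain b where b: "\<And>e. \<tau> (b e) = opL rg sr e"
    using edge_preimages by blast
  \<comment> \<open>Under \<open>\<tau>\<close>, applying \<open>D m\<close> means multiplying by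
    the first \<open>m\<close> edges of the itinerary in the order in which they are
    traversed.\<close>
  define D where "D = left_mult_upto (\<lambda>m. b (\<phi> (?v m)))"
  have D_0: "D 0 a = a" and D_Suc: "D (Suc m) a = b (\<phi> (?v m)) * D m a" for m a
    by (simp_all add: D_def)
  have D_bl: "bounded_linear (D m)" for m
    unfolding D_def by (rule bounded_linear_left_mult_upto)
  \<comment> \<open>At a return time \<open>n\<close>, the edges multiplied by \<open>D m\<close>
    are precisely those that lead from \<open>p n\<close> to \<open>p (n + m)\<close>, so the
    coordinate is merely moved along.\<close>
  have D_keep: "\<tau> (D m a) x (p (n + m)) = \<tau> a x (p n)" if "?v n = ?v 0" for m n a
  proof (induction m)
    case 0
    then show ?case
      by (simp add: D_0)
  next
    case (Suc m)
    have "\<tau> (D (Suc m) a) x (p (n + Suc m))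
        = opL rg sr (\<phi> (?v m)) (\<tau> (D m a) x) (extend_path (\<phi> (?v m)) (p (n + m)))"
      by (simp add: D_Suc tau_mult b p_Suc v_shift[OF that])
    also have "\<dots> = \<tau> (D m a) x (p (n + m))"
      by (intro opL_extend_path tau_in_l2G x p_in) (simp add: \<phi> v_shift[OF that])
    finally show ?case
      using Suc by simp
  qed
  have D_kill: "\<tau> (D m a) x u = 0"
    if "\<And>u. path_length u < l \<Longrightarrow> \<tau> a x u = 0" "path_length u < l + m" for m l a u
    using that(2)
  proof (induction m arbitrary: u)
    case 0
    then show ?case
      by (simp add: D_0 that(1))
  next
    case (Suc m)
    then show ?case
      unfolding D_Suc tau_mult b by (intro opL_eq_0_if_short[of "l + m"]) auto
  qed
  define R where "R n = D Q" for n :: nat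
  \<comment> \<open>Since \<open>R\<close> is constant, its iterates are powers of
    \<open>D Q\<close>, and a factor can also be split off on the left.\<close>
  have iter_Suc: "iterate_from R 0 (Suc m) a = D Q (iterate_from R 0 m a)" for m a
    by (induction m arbitrary: a) (simp_all add: R_def)
  have keep: "\<tau> (iterate_from R 0 m a) x (p (m * Q)) = \<tau> a x (p 0)" for m a
  proof (induction m)
    case (Suc m)
    then show ?case
      using D_keep[OF v_Q, of Q "iterate_from R 0 m a" m]
      by (simp add: iter_Suc add.commute del: iterate_from.simps)
  qed simp
  have kill: "\<tau> (iterate_from R 0 m a) x u = 0" if "path_length u < m * Q" for m a u
    using that
  proof (induction m arbitrary: u)
    case (Suc m)
    then show ?case
      unfolding iter_Suc by (intro D_kill[of "m * Q"]) (simp_all add: add.commute)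
  qed simp
  show False
  proof (rule no_gliding_hump[OF x, of R "\<lambda>n. p (n * Q)"])
    show "bounded_linear (R n)" for n
      by (simp add: R_def D_bl)
    show "\<not> bounded_linear (\<lambda>a. \<tau> (iterate_from R 0 n a) x (p (n * Q)))" for n
      using unb by (simp add: keep)
    show "\<tau> (iterate_from R 0 (Suc n) a) x (p (n * Q)) = 0" for n a
      using Q by (intro kill) (simp add: len[of "n * Q"])
  qed
qed

text \<open>An unbounded coordinate starts an infinite path of unbounded coordinates. Infinitely
  many vertices on it are excluded by one hump argument, and the resulting repetition of a vertex by
  the other.\<close>

lemma bounded_linear_coordinate:
  assumes "has_no_sinks sr" and x: "x \<in> l2G rg sr"
  shows "bounded_linear (\<lambda>a. \<tau> a x w)"
proof (rule ccontr)
  assume unb_w: "\<not> ?thesis"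
  \<comment> \<open>Fixing one outgoing edge per vertex makes the path deterministic, so a repeated
    vertex forces periodicity.\<close>
  define \<phi> where "\<phi> v = (SOME e. sr e = v)" for v
  have \<phi>: "sr (\<phi> v) = v" for v
    unfolding \<phi>_def by (rule someI_ex) (use assms(1) in \<open>simp add: has_no_sinks_def\<close>)
  have w: "w \<in> fsg_paths rg sr"
  proof (rule ccontr)
    assume "w \<notin> fsg_paths rg sr"
    then have "(\<lambda>a. \<tau> a x w) = (\<lambda>a. 0)"
      by (intro ext l2G_D(1)[OF tau_in_l2G[OF x]])
    then show False
      using unb_w by (simp add: bounded_linear_zero)
  qed
  define p where "p n = ((\<lambda>q. extend_path (\<phi> (path_range rg q)) q) ^^ n) w" for n
  have p_Suc: "p (Suc n) = extend_path (\<phi> (path_range rg (p n))) (p n)" for n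
    by (simp add: p_def)
  have p_in: "p n \<in> fsg_paths rg sr" for n
  proof (induction n)
    case 0
    then show ?case
      by (simp add: p_def w)
  next
    case (Suc n)
    then show ?case
      unfolding p_Suc by (rule extend_path_in_fsg_paths) (rule \<phi>)
  qed
  have unb: "\<not> bounded_linear (\<lambda>a. \<tau> a x (p n))" for n
  proof (induction n)
    case 0
    then show ?case
      using unb_w by (simp add: p_def)
  next
    case (Suc n)
    show ?case
      unfolding p_Suc by (rule unbounded_coordinate_extend[OF x p_in \<phi> Suc])
  qed
  have "\<not> inj (\<lambda>n. path_range rg (p n))"
    using finitely_many_unbounded_ranges[OF x unb] by (auto dest: range_inj_infinite)
  then obtain i j where ij: "i < j" "path_range rg (p i) = path_range rg (p j)"
    using linorder_injI[of "\<lambda>n. path_range rg (p n)"] by blast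
  show False
  proof (rule no_periodic_unbounded_path[OF x, of "\<lambda>n. p (i + n)" \<phi> "j - i"])
    show "p (i + Suc n) = extend_path (\<phi> (path_range rg (p (i + n)))) (p (i + n))" for n
      using p_Suc[of "i + n"] by simp
    show "path_range rg (p (i + (j - i))) = path_range rg (p (i + 0))"
      using ij by simp
  qed (use p_in \<phi> unb ij(1) in auto)
qed

text \<open>Uniform boundedness is applied to the finite sections of the norm of
  \<open>\<tau> a x\<close>, with \<open>x\<close> in the unit ball. They are continuous in
  \<open>a\<close> because single coordinates are, and bounded for fixed \<open>a\<close> because
  \<open>\<tau> a\<close> is a bounded operator.\<close>

lemma l2norm_tau_bounded:
  assumes "has_no_sinks sr"
  shows "\<exists>C\<ge>0. \<forall>a. \<forall>x\<in>l2G rg sr. l2norm x \<le> 1 \<longrightarrow> l2norm (\<tau> a x) \<le> C * norm a"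
proof -
  define I where "I = {x \<in> l2G rg sr. l2norm x \<le> 1} \<times> {F::('v, 'e) gpath set. finite F}"
  define q where "q i a = L2_set (\<lambda>u. norm (\<tau> a (fst i) u)) (snd i)"
    for i :: "(('v, 'e) gpath \<Rightarrow> complex) \<times> ('v, 'e) gpath set" and a
  have "\<exists>C\<ge>0. \<forall>i\<in>I. \<forall>a. q i a \<le> C * norm a"
  proof (rule uniform_boundedness_seminorms)
    fix i :: "(('v, 'e) gpath \<Rightarrow> complex) \<times> ('v, 'e) gpath set" assume i: "i \<in> I"
    obtain x F where xF: "i = (x, F)"
      by (cases i)
    have x: "x \<in> l2G rg sr"
      using i by (simp add: I_def xF)
    have "continuous_on UNIV (\<lambda>a. \<tau> a x u)" for u
      by (rule linear_continuous_on[OF bounded_linear_coordinate[OF assms x]])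
    then show "continuous_on UNIV (q i)"
      unfolding q_def L2_set_def xF fst_conv snd_conv by (intro continuous_intros)
    show "q i (a + b) \<le> q i a + q i b" for a b
    proof -
      have "q i (a + b) \<le> L2_set (\<lambda>u. norm (\<tau> a x u) + norm (\<tau> b x u)) F"
        unfolding q_def xF fst_conv snd_conv
        by (intro L2_set_mono) (simp_all add: linear_add[OF linear_coordinate] norm_triangle_ineq)
      also have "\<dots> \<le> q i a + q i b"
        unfolding q_def xF fst_conv snd_conv by (rule L2_set_triangle_ineq)
      finally show ?thesis .
    qed
    show "q i (r *\<^sub>R a) = \<bar>r\<bar> * q i a" for r a
      by (simp add: q_def linear_scale[OF linear_coordinate] L2_set_right_distrib)
  next
    fix a
    obtain K where K: "\<And>x. x \<in> l2G rg sr \<Longrightarrow> l2norm (\<tau> a x) \<le> K * l2norm x"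
      using tau_in_bopG[of a] unfolding bopG_def by blast
    have "q (x, F) a \<le> \<bar>K\<bar>" if "x \<in> l2G rg sr" "l2norm x \<le> 1" "finite F" for x F
    proof -
      have "q (x, F) a \<le> l2norm (\<tau> a x)"
        using L2_set_le_l2norm[OF tau_in_l2G[OF that(1)] that(3)] by (simp add: q_def)
      also have "\<dots> \<le> \<bar>K\<bar> * l2norm x"
        using K[OF that(1)] mult_right_mono[OF abs_ge_self l2norm_nonneg] order_trans by blast
      also have "\<dots> \<le> \<bar>K\<bar> * 1"
        using that(2) by (intro mult_left_mono) auto
      finally show ?thesis
        by simp
    qed
    then show "\<exists>B. \<forall>i\<in>I. q i a \<le> B"
      by (auto simp: I_def)
  qed
  then obtain C where C: "C \<ge> 0" "\<And>i a. i \<in> I \<Longrightarrow> q i a \<le> C * norm a"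
    by blast
  have "l2norm (\<tau> a x) \<le> C * norm a" if "x \<in> l2G rg sr" "l2norm x \<le> 1" for a x
  proof (rule l2norm_leI[OF tau_in_l2G[OF that(1)]])
    show "L2_set (\<lambda>u. norm (\<tau> a x u)) F \<le> C * norm a" if "finite F" for F
      using C(2)[of "(x, F)" a] that \<open>x \<in> l2G rg sr\<close> \<open>l2norm x \<le> 1\<close> by (simp add: q_def I_def)
  qed
  then show ?thesis
    using C(1) by blast
qed

end

section \<open>Norm continuity of the homomorphism\<close>

theorem theorem3p10:
  fixes rg sr :: "'e::countable \<Rightarrow> 'v::countable"
    and sm :: "complex \<Rightarrow> 'a::{real_normed_algebra, banach} \<Rightarrow> 'a"
    and \<tau> :: "'a \<Rightarrow> ((('v, 'e) gpath \<Rightarrow> complex) \<Rightarrow> (('v, 'e) gpath \<Rightarrow> complex))"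
  assumes "has_no_sinks sr"
    and "complex_banach_algebra_smul sm"
    and "alg_homG sm \<tau>"
    and "\<tau> ` UNIV = freeSemigroupoidAlg rg sr"
  shows "\<forall>a. \<forall>\<epsilon>>0. \<exists>\<delta>>0. \<forall>b. norm (b - a) < \<delta> \<longrightarrow>
           opnormG rg sr (\<lambda>x u. \<tau> b x u - \<tau> a x u) < \<epsilon>"
proof -
  interpret hom_onto_freeSemigroupoidAlg rg sr sm \<tau>
    by standard (rule assms)+
  obtain C where C: "C \<ge> 0"
    "\<And>a x. x \<in> l2G rg sr \<Longrightarrow> l2norm x \<le> 1 \<Longrightarrow> l2norm (\<tau> a x) \<le> C * norm a"
    using l2norm_tau_bounded[OF assms(1)] by blast
  have bound: "opnormG rg sr (\<lambda>x u. \<tau> b x u - \<tau> a x u) \<le> C * norm (b - a)" for a b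
    unfolding opnormG_def
  proof (rule cSup_least)
    have "l2norm (\<lambda>u::('v, 'e) gpath. 0) \<le> 1"
      by (simp add: l2norm_def)
    then show "{l2norm (\<lambda>u. \<tau> b x u - \<tau> a x u) |x. x \<in> l2G rg sr \<and> l2norm x \<le> 1} \<noteq> {}"
      using l2G_zero by blast
  next
    fix y assume "y \<in> {l2norm (\<lambda>u. \<tau> b x u - \<tau> a x u) |x. x \<in> l2G rg sr \<and> l2norm x \<le> 1}"
    then obtain x where x: "x \<in> l2G rg sr" "l2norm x \<le> 1"
      and y: "y = l2norm (\<lambda>u. \<tau> b x u - \<tau> a x u)"
      by blast
    have "y = l2norm (\<tau> (b - a) x)"
      unfolding y by (simp flip: linear_diff[OF linear_coordinate])
    then show "y \<le> C * norm (b - a)"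
      using C(2)[OF x] by simp
  qed
  show ?thesis
  proof (intro allI impI)
    fix a :: 'a and \<epsilon> :: real assume "0 < \<epsilon>"
    \<comment> \<open>The radius uses \<open>C + 1\<close> because \<open>C\<close> may be
      zero.\<close>
    have "opnormG rg sr (\<lambda>x u. \<tau> b x u - \<tau> a x u) < \<epsilon>" if "norm (b - a) < \<epsilon> / (C + 1)" for b
    proof -
      have "C * norm (b - a) \<le> (C + 1) * norm (b - a)"
        by (simp add: mult_right_mono)
      also have "\<dots> < \<epsilon>"
        using that C(1) by (simp add: field_simps)
      finally show ?thesis
        using bound[of b a] by linarith
    qed
    then show "\<exists>\<delta>>0. \<forall>b. norm (b - a) < \<delta> \<longrightarrow>
        opnormG rg sr (\<lambda>x u. \<tau> b x u - \<tau> a x u) < \<epsilon>"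
      using \<open>0 < \<epsilon>\<close> C(1) by (intro exI[of _ "\<epsilon> / (C + 1)"]) simp
  qed
qed

end
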